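(* Let $k\ge 1$ and $n=p_1\cdots p_k$ with $p_1<\cdots<p_k$ odd primes. Then $g(\Psi_n)\ge\delta^-(n)$, where $\delta^-(n)=2\,\frac{n}{p_1}-\psi(n)$.
   Context: $\Psi_n(x)=\prod_{1\le j\le n,\ \gcd(j,n)\ne1}(x-e^{2\pi i j/n})$ is the $n$-th inverse cyclotomic polynomial. For a polynomial $f=c_1x^{\nu_1}+\cdots+c_tx^{\nu_t}$ with all $c_i\ne0$ and $0\le\nu_1<\cdots<\nu_t$, the maximum gap is $g(f)=\max_{1\le i<t}(\nu_{i+1}-\nu_i)$ if $t\ne1$, and $g(f)=0$ if $t=1$. $\psi(n)=\deg\Psi_n=n-\varphi(n)$, where $\varphi$ is Euler's totient. *)

theory Defs
  imports
    "HOL-Analysis.Complex_Transcendental"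
    "HOL-Computational_Algebra.Polynomial"
    "HOL-Number_Theory.Totient"
begin

definition inv_cyclotomic :: "nat \<Rightarrow> complex poly" where
  "inv_cyclotomic n =
     (\<Prod>j | 1 \<le> j \<and> j \<le> n \<and> gcd j n \<noteq> 1.
        [:- exp (2 * of_real pi * \<i> * of_nat j / of_nat n), 1:])"

definition psi :: "nat \<Rightarrow> nat" where
  "psi n = degree (inv_cyclotomic n)"

lemma psi_eq: "psi n = n - totient n"
proof -
  let ?A = "{j. 1 \<le> j \<and> j \<le> n \<and> gcd j n \<noteq> 1}"
  have A: "?A = {0<..n} - totatives n"
    by (auto simp: totatives_def coprime_iff_gcd_eq_1)
  have "psi n = card ?A"
    unfolding psi_def inv_cyclotomic_def
    by (subst degree_prod_eq_sum_degree) auto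
  also have "\<dots> = n - totient n"
    unfolding A totient_def
    by (subst card_Diff_subset) (auto simp: totatives_def)
  finally show ?thesis .
qed

text \<open>The increasing list \<open>\<nu>\<^sub>1 < \<dots> < \<nu>\<^sub>t\<close> of exponents that occur in a polynomial,
  indexed from 0 by the list operations.\<close>

definition exponents :: "'a::zero poly \<Rightarrow> nat list" where
  "exponents f = sorted_list_of_set {i. coeff f i \<noteq> 0}"

text \<open>The zero polynomial (\<open>t = 0\<close>) also gets the value 0.\<close>

definition max_gap :: "'a::zero poly \<Rightarrow> nat" where
  "max_gap f =
     (let \<nu> = exponents f; t = length \<nu> in
      if t \<le> 1 then 0
      else Max {\<nu> ! (i + 1) - \<nu> ! i | i. i + 1 < t})"

end

theory Submission
  imports Defs
begin

text \<open>
  Let \<open>d > 1\<close> divide \<open>n\<close> and put \<open>m = n / d\<close>. The \<open>m\<close>-th roots of unity are among the roots of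
  \<open>\<Psi>\<^sub>n\<close>, so \<open>\<Psi>\<^sub>n = (x\<^sup>m - 1) G\<close> with \<open>deg G = \<psi>(n) - m\<close> and \<open>G(0) \<noteq> 0\<close>. When \<open>deg G < m\<close>, the
  blocks \<open>x\<^sup>m G\<close> and \<open>- G\<close> do not overlap, and the exponents between \<open>deg G\<close> and \<open>m\<close> form a gap of
  length \<open>2 m - \<psi>(n)\<close>.
\<close>

text \<open>The entry after \<open>i\<close> in the sorted exponent list cannot lie strictly between
  \<open>i\<close> and \<open>j\<close>, so the gap starting at \<open>i\<close> already has length
  at least \<open>j - i\<close>. This allows gaps to be read off from coefficients alone.\<close>

lemma max_gap_ge:
  assumes "i < j" "coeff f i \<noteq> 0" "coeff f j \<noteq> 0"
    and zero: "\<And>l. i < l \<Longrightarrow> l < j \<Longrightarrow> coeff f l = 0"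
  shows "j - i \<le> max_gap f"
proof -
  define S where "S = {i. coeff f i \<noteq> 0}"
  define \<nu> where "\<nu> = exponents f"
  have "S \<subseteq> {..degree f}"
    by (auto simp: S_def le_degree)
  then have "finite S"
    by (rule finite_subset) auto
  then have set: "set \<nu> = S" and sorted: "sorted_wrt (<) \<nu>"
    by (auto simp: \<nu>_def exponents_def S_def)
  obtain a where a: "a < length \<nu>" "\<nu> ! a = i"
    using assms(2) set in_set_conv_nth[of i \<nu>] by (auto simp: S_def)
  obtain b where b: "b < length \<nu>" "\<nu> ! b = j"
    using assms(3) set in_set_conv_nth[of j \<nu>] by (auto simp: S_def)
  have "a < b"
  proof (rule ccontr)
    assume "\<not> a < b"
    then have "b < a \<or> b = a" by auto
    then show False
      using sorted_wrt_nth_less[OF sorted, of b a] a b \<open>i < j\<close> by auto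
  qed
  then have succ: "a + 1 < length \<nu>"
    using b by simp
  have "i < \<nu> ! (a + 1)"
    using sorted_wrt_nth_less[OF sorted, of a "a + 1"] succ a by simp
  moreover have "coeff f (\<nu> ! (a + 1)) \<noteq> 0"
    using nth_mem[OF succ] set by (simp add: S_def)
  ultimately have "j \<le> \<nu> ! (a + 1)"
    using zero by (meson not_le)
  then have "j - i \<le> \<nu> ! (a + 1) - \<nu> ! a"
    using a by simp
  also have "\<dots> \<le> Max {\<nu> ! (i + 1) - \<nu> ! i | i. i + 1 < length \<nu>}"
  proof (rule Max_ge)
    have "{\<nu> ! (i + 1) - \<nu> ! i | i. i + 1 < length \<nu>} \<subseteq>
        (\<lambda>i. \<nu> ! (i + 1) - \<nu> ! i) ` {..<length \<nu>}"
      by auto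
    then show "finite {\<nu> ! (i + 1) - \<nu> ! i | i. i + 1 < length \<nu>}"
      by (rule finite_subset) auto
  qed (use succ in blast)
  also have "\<dots> = max_gap f"
    using succ by (simp add: max_gap_def \<nu>_def Let_def)
  finally show ?thesis .
qed

text \<open>Both sides have degree \<open>m\<close> and leading coefficient 1, and both vanish at
  the \<open>m\<close> distinct \<open>m\<close>-th roots of unity. Their difference has degree
  below \<open>m\<close> and \<open>m\<close> zeros, hence is 0.\<close>

lemma prod_roots_of_unity:
  assumes "m > 0"
  shows "(\<Prod>j=1..m. [:- exp (2 * of_real pi * \<i> * of_nat j / of_nat m), 1:]) =
    (monom 1 m - 1 :: complex poly)" (is "?P = ?Q")
proof -
  let ?e = "\<lambda>j. exp (2 * of_real pi * \<i> * of_nat j / of_nat m) :: complex"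
  have inj: "inj_on ?e {1..m}"
  proof (rule inj_onI)
    fix i j assume ij: "i \<in> {1..m}" "j \<in> {1..m}" "?e i = ?e j"
    then have "[i = j] (mod m)"
      using complex_root_unity_eq[of m i j] \<open>m > 0\<close> by (simp add: cong_def)
    \<comment> \<open>The indices run over \<open>{1..m}\<close>, so the residue 0 is represented by
      \<open>m\<close>; hence the case split.\<close>
    with ij show "i = j"
      by (cases "i = m"; cases "j = m") (auto simp: cong_def)
  qed
  have degP: "degree ?P = m"
    by (subst degree_prod_eq_sum_degree) auto
  have degQ: "degree ?Q = m"
    using assms by (intro antisym degree_le le_degree) auto
  show ?thesis
  proof (rule poly_eqI_degree_lead_coeff[where A = "?e ` {1..m}" and n = m])
    show "coeff ?P m = coeff ?Q m"
      using lead_coeff_prod[of "\<lambda>j. [:- ?e j, 1:]" "{1..m}"] degP assms by simp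
    fix z assume "z \<in> ?e ` {1..m}"
    then obtain j where j: "j \<in> {1..m}" "z = ?e j"
      by blast
    then have "poly ?P z = 0"
      by (auto simp: poly_prod)
    moreover have "poly ?Q z = 0"
      using complex_root_unity[of m j] j assms by (simp add: poly_monom)
    ultimately show "poly ?P z = poly ?Q z"
      by simp
  qed (use inj degP degQ in \<open>auto simp: card_image\<close>)
qed

text \<open>An index \<open>i * d\<close> shares the factor \<open>d\<close> with \<open>n\<close>,
  and cancelling \<open>d\<close> in the exponent turns its root into an \<open>m\<close>-th root of
  unity, where \<open>m = n div d\<close>. The remaining indices form \<open>G\<close>, whose roots
  are values of \<open>exp\<close> and so are nonzero.\<close>

lemma inv_cyclotomic_factor:
  assumes "d dvd n" "d > 1" "n > 0"
  obtains G where "inv_cyclotomic n = (monom 1 (n div d) - 1) * G" "coeff G 0 \<noteq> 0"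
proof -
  define m where "m = n div d"
  have n: "n = m * d" and "m > 0"
    using assms by (auto simp: m_def)
  let ?f = "\<lambda>j. [:- exp (2 * of_real pi * \<i> * of_nat j / of_nat n), 1:] :: complex poly"
  define A where "A = {j. 1 \<le> j \<and> j \<le> n \<and> gcd j n \<noteq> 1}"
  define B where "B = (\<lambda>i. i * d) ` {1..m}"
  have "finite A"
    by (simp add: A_def)
  have "B \<subseteq> A"
  proof
    fix j assume "j \<in> B"
    then obtain i where i: "i \<in> {1..m}" "j = i * d"
      by (auto simp: B_def)
    then have "d dvd gcd j n"
      using \<open>d dvd n\<close> by simp
    then have "gcd j n \<noteq> 1"
      using \<open>d > 1\<close> by (metis nat_dvd_1_iff_1 less_irrefl)
    then show "j \<in> A"
      using i \<open>d > 1\<close> by (simp add: A_def n)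
  qed
  have "inv_cyclotomic n = prod ?f (A - B) * prod ?f B"
    using prod.subset_diff[OF \<open>B \<subseteq> A\<close> \<open>finite A\<close>] by (simp add: inv_cyclotomic_def A_def)
  also have "prod ?f B = (\<Prod>i=1..m. ?f (i * d))"
    unfolding B_def using \<open>d > 1\<close> by (subst prod.reindex) (auto simp: inj_on_def)
  also have "\<dots> = (\<Prod>i=1..m. [:- exp (2 * of_real pi * \<i> * of_nat i / of_nat m), 1:])"
    using \<open>d > 1\<close> by (intro prod.cong) (auto simp: n mult.assoc)
  also have "\<dots> = monom 1 m - 1"
    using \<open>m > 0\<close> by (rule prod_roots_of_unity)
  finally have "inv_cyclotomic n = (monom 1 m - 1) * prod ?f (A - B)"
    by (simp add: mult.commute)
  moreover have "coeff (prod ?f (A - B)) 0 \<noteq> 0"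
    using \<open>finite A\<close> by (simp add: poly_prod flip: poly_0_coeff_0)
  ultimately show ?thesis
    unfolding m_def by (rule that)
qed

lemma max_gap_inv_cyclotomic_ge:
  assumes "d dvd n" "d > 1" "n > 0"
  shows "real (max_gap (inv_cyclotomic n)) \<ge> 2 * real (n div d) - real (psi n)"
proof -
  define m where "m = n div d"
  have "m > 0"
    using assms by (auto simp: m_def)
  obtain G where G: "inv_cyclotomic n = (monom 1 m - 1) * G" "coeff G 0 \<noteq> 0"
    using inv_cyclotomic_factor[OF assms] by (auto simp: m_def)
  have coeff: "coeff (inv_cyclotomic n) l = (if l < m then 0 else coeff G (l - m)) - coeff G l" for l
    unfolding G(1) by (simp add: left_diff_distrib coeff_monom_mult)
  have deg: "degree (monom 1 m - 1 :: complex poly) = m"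
    using \<open>m > 0\<close> by (intro antisym degree_le le_degree) auto
  have psi: "psi n = m + degree G"
    unfolding psi_def G(1)
    using deg \<open>m > 0\<close> G(2) by (subst degree_mult_eq) auto
  show ?thesis
  proof (cases "degree G < m")
    case True
    have "m - degree G \<le> max_gap (inv_cyclotomic n)"
    proof (rule max_gap_ge)
      \<comment> \<open>Below \<open>m\<close> only \<open>- G\<close> contributes, here with minus
        the leading coefficient of \<open>G\<close>.\<close>
      show "coeff (inv_cyclotomic n) (degree G) \<noteq> 0"
        using True G(2) by (auto simp: coeff)
      \<comment> \<open>At \<open>m\<close> the block \<open>- G\<close> has ended, which leaves the
        constant term of \<open>G\<close>.\<close>
      show "coeff (inv_cyclotomic n) m \<noteq> 0"
        using True G(2) by (simp add: coeff coeff_eq_0)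
    qed (use True in \<open>auto simp: coeff coeff_eq_0\<close>)
    then show ?thesis
      using True psi by (simp add: m_def)
  next
    \<comment> \<open>The claimed bound equals \<open>m - degree G\<close> over the reals, which is
      at most 0 here.\<close>
    case False
    then show ?thesis
      using psi by (simp add: m_def)
  qed
qed

theorem theorem4:
  fixes k n :: nat and p :: "nat \<Rightarrow> nat"
  assumes "k \<ge> 1"
    and "\<And>i. i \<in> {1..k} \<Longrightarrow> prime (p i) \<and> odd (p i)"
    and "strict_mono_on {1..k} p"
    and "n = (\<Prod>i=1..k. p i)"
  shows "real (max_gap (inv_cyclotomic n)) \<ge> 2 * (real n / real (p 1)) - real (psi n)"
proof -
  have dvd: "p 1 dvd n"
    unfolding assms(4) using assms(1) by (intro dvd_prodI) auto
  have "p 1 > 1"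
    using assms(1) assms(2)[of 1] by (simp add: prime_gt_Suc_0_nat)
  moreover have "n > 0"
    unfolding assms(4) using assms(2) by (intro prod_pos) (auto intro: prime_gt_0_nat)
  \<comment> \<open>Take \<open>d = p 1\<close>; divisibility makes \<open>n div p 1\<close> agree
    with the real quotient.\<close>
  ultimately show ?thesis
    using max_gap_inv_cyclotomic_ge[OF dvd] dvd by (simp add: real_of_nat_div)
qed

end
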